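(* Let $\Sigma\subset\mathbb{T}$ be a line congruence. Then $\Sigma$ is locally the graph of a section of the bundle $\pi:\mathbb{T}\rightarrow\mathbb{P}^1$ (i.e. every $\gamma\in\Sigma$ has a neighbourhood in $\Sigma$ which is the graph of a smooth section of $\pi$ over an open subset of $\mathbb{P}^1$) if and only if the curvature of $\Sigma$ is non-zero (at every $\gamma\in\Sigma$).
   Context: Oriented lines. The space of oriented lines in $\mathbb{R}^3$ is $\mathbb{T}=\{(\vec U,\vec W)\in\mathbb{R}^3\times\mathbb{R}^3 : \langle\vec U,\vec W\rangle=0,\ |\vec W|=1\}\cong TS^2=T\mathbb{P}^1$; the pair $(\vec U,\vec W)$ is the oriented line $\{\vec U+r\vec W: r\in\mathbb{R}\}$, and $\pi(\vec U,\vec W)=\vec W\in S^2=\mathbb{P}^1$. A line congruence is a smooth (immersed) real surface $\Sigma\subset\mathbb{T}$, i.e. a 2-parameter family of oriented lines. Coordinates. On $\mathbb{R}^3$ put $z=x^1+ix^2$, $t=x^3$. Let $\xi$ be the holomorphic coordinate on $\mathbb{P}^1=S^2$ given by stereographic projection from the South pole (so the direction $\vec W$ has $z$-component $\frac{2\xi}{1+\xi\bar\xi}$ and $t$-component $\frac{1-\xi\bar\xi}{1+\xi\bar\xi}$). The point $F\frac{\partial}{\partial\xi}\in T_\xi\mathbb{P}^1$ has coordinates $(\xi,F)\in\mathbb{C}^2$ and corresponds to the oriented line, parametrised by arclength $r$, $$z=\frac{2(F-\bar F\xi^2)+2\xi(1+\xi\bar\xi)r}{(1+\xi\bar\xi)^2},\qquad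 t=\frac{-2(F\bar\xi+\bar F\xi)+(1-\xi^2\bar\xi^2)r}{(1+\xi\bar\xi)^2}.$$ A congruence is locally parametrised by smooth functions $\xi(u,v),F(u,v)$ of real parameters $u,v$, with $(u,v)\mapsto(\xi,F)$ an immersion. (Lines in the South pole direction are treated after a rotation of $\mathbb{R}^3$.) Put $\nu=u+iv$, $\partial=\partial/\partial\nu$, $\bar\partial=\partial/\partial\bar\nu$, and $$\partial^+F=\partial F+r\,\partial\xi-\frac{2F\bar\xi\,\partial\xi}{1+\xi\bar\xi},\qquad \partial^-F=\bar\partial F+r\,\bar\partial\xi-\frac{2F\bar\xi\,\bar\partial\xi}{1+\xi\bar\xi},$$ $$\Delta=\frac{4}{(1+\xi\bar\xi)^2}\left(\partial^+F\,\overline{\partial^+F}-\partial^-F\,\overline{\partial^-F}\right).$$ Curvature. At points $(u,v,r)$ with $\Delta\neq0$ set $$\rho=\frac{\partial^+F\,\bar\partial\bar\xi-\partial^-F\,\partial\bar\xi}{\partial^-F\,\overline{\partial^-F}-\partial^+F\,\overline{\partial^+F}},\qquad \sigma=\frac{\overline{\partial^+F}\,\partial\bar\xi-\overline{\partial^-F}\,\bar\partial\bar\xi}{\partial^-F\,\overline{\partial^-F}-\partial^+F\,\overline{\partial^+F}}.$$ The curvature of the congruence is $K=\rho\bar\rho-\sigma\bar\sigma$. The curvature is non-zero at $\gamma\in\Sigma$ if $\Delta\ne0$ at some point of $\gamma$ and $K\neq 0$ at the points of $\gamma$ where $\Delta\neq0$. *)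

theory Defs
  imports "HOL-Analysis.Analysis"
begin

fun Ck_on :: "nat \<Rightarrow> ('a::real_normed_vector \<Rightarrow> 'b::real_normed_vector) \<Rightarrow> 'a set \<Rightarrow> bool" where
  "Ck_on 0 f S \<longleftrightarrow> continuous_on S f"
| "Ck_on (Suc k) f S \<longleftrightarrow>
     (\<forall>x\<in>S. f differentiable (at x)) \<and> (\<forall>v. Ck_on k (\<lambda>x. frechet_derivative f (at x) v) S)"

text \<open>Intended for open sets \<open>S\<close> only; see \<open>smooth_map_on\<close> for other sets.\<close>
definition smooth_on :: "'a::real_normed_vector set \<Rightarrow> ('a \<Rightarrow> 'b::real_normed_vector) \<Rightarrow> bool" where
  "smooth_on S f \<longleftrightarrow> (\<forall>k. Ck_on k f S)"

text \<open>Smoothness on a set that need not be open in the ambient space (here: a subset of the unit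
  sphere), by means of local smooth extensions.\<close>
definition smooth_map_on :: "'a::real_normed_vector set \<Rightarrow> ('a \<Rightarrow> 'b::real_normed_vector) \<Rightarrow> bool" where
  "smooth_map_on V s \<longleftrightarrow>
     (\<forall>x\<in>V. \<exists>N h. open N \<and> x \<in> N \<and> smooth_on N h \<and> (\<forall>y\<in>N \<inter> V. h y = s y))"

definition immersion_on :: "'a::real_normed_vector set \<Rightarrow> ('a \<Rightarrow> 'b::real_normed_vector) \<Rightarrow> bool" where
  "immersion_on S f \<longleftrightarrow> smooth_on S f \<and> (\<forall>x\<in>S. inj (frechet_derivative f (at x)))"

text \<open>An abstract smooth surface: a topology \<open>X\<close> with an atlas \<open>A\<close> (not necessarily maximal) of
  charts \<open>(U, \<phi>)\<close>. The two real parameters \<open>u\<close>, \<open>v\<close> of a chart are combined into the complex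
  parameter \<open>\<nu> = u + iv\<close>, smoothness being understood over the reals.\<close>
definition smooth_surface :: "'m topology \<Rightarrow> ('m set \<times> ('m \<Rightarrow> complex)) set \<Rightarrow> bool" where
  "smooth_surface X A \<longleftrightarrow>
     Hausdorff_space X \<and> second_countable X \<and>
     (\<Union>(U, \<phi>)\<in>A. U) = topspace X \<and>
     (\<forall>(U, \<phi>)\<in>A. openin X U \<and> open (\<phi> ` U) \<and>
        homeomorphic_map (subtopology X U) (top_of_set (\<phi> ` U)) \<phi>) \<and>
     (\<forall>(U, \<phi>)\<in>A. \<forall>(V, \<psi>)\<in>A. smooth_on (\<phi> ` (U \<inter> V)) (\<psi> \<circ> inv_into U \<phi>))"

type_synonym oline = "(real^3) \<times> (real^3)"

definition oriented_lines :: "oline set" where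
  "oriented_lines = {(U, W). U \<bullet> W = 0 \<and> norm W = 1}"

abbreviation line_dir :: "oline \<Rightarrow> real^3" where
  "line_dir \<equiv> snd"

text \<open>A line congruence is an immersed surface in the space of oriented lines, given by an immersion
  \<open>f\<close> of an abstract surface. The space of oriented lines is a submanifold of
  \<open>\<real>\<^sup>3 \<times> \<real>\<^sup>3\<close>, so smoothness and immersivity may be tested in the ambient space.\<close>
definition line_congruence ::
    "'m topology \<Rightarrow> ('m set \<times> ('m \<Rightarrow> complex)) set \<Rightarrow> ('m \<Rightarrow> oline) \<Rightarrow> bool" where
  "line_congruence X A f \<longleftrightarrow>
     smooth_surface X A \<and> f ` topspace X \<subseteq> oriented_lines \<and>
     (\<forall>(U, \<phi>)\<in>A. immersion_on (\<phi> ` U) (f \<circ> inv_into U \<phi>))"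

definition smooth_section_on :: "(real^3) set \<Rightarrow> (real^3 \<Rightarrow> oline) \<Rightarrow> bool" where
  "smooth_section_on V s \<longleftrightarrow>
     smooth_map_on V s \<and> (\<forall>W\<in>V. s W \<in> oriented_lines \<and> line_dir (s W) = W)"

text \<open>Neighbourhoods are taken in the topology of the surface itself, so that the sheets of a
  congruence passing through the same line are treated separately. A neighbourhood \<open>N\<close> on
  which \<open>f\<close> is injective is identified with the set of lines \<open>f ` N\<close>; the graph of a section \<open>s\<close>
  over \<open>V\<close> is \<open>s ` V\<close>.\<close>
definition locally_graph_at :: "'m topology \<Rightarrow> ('m \<Rightarrow> oline) \<Rightarrow> 'm \<Rightarrow> bool" where
  "locally_graph_at X f m \<longleftrightarrow>
     (\<exists>N V s. openin X N \<and> m \<in> N \<and> inj_on f N \<and>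
        openin (top_of_set (sphere 0 1)) V \<and> smooth_section_on V s \<and> f ` N = s ` V)"

definition line_point_z :: "complex \<Rightarrow> complex \<Rightarrow> real \<Rightarrow> complex" where
  "line_point_z \<xi> F r =
     (2 * (F - cnj F * \<xi>\<^sup>2) + 2 * \<xi> * (1 + \<xi> * cnj \<xi>) * of_real r) / (1 + \<xi> * cnj \<xi>)\<^sup>2"

definition line_point_t :: "complex \<Rightarrow> complex \<Rightarrow> real \<Rightarrow> complex" where
  "line_point_t \<xi> F r =
     (- 2 * (F * cnj \<xi> + cnj F * \<xi>) + (1 - \<xi>\<^sup>2 * (cnj \<xi>)\<^sup>2) * of_real r) / (1 + \<xi> * cnj \<xi>)\<^sup>2"

text \<open>\<open>line_point_t\<close> is always real.\<close>
definition line_point :: "complex \<Rightarrow> complex \<Rightarrow> real \<Rightarrow> real^3" where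
  "line_point \<xi> F r =
     vector [Re (line_point_z \<xi> F r), Im (line_point_z \<xi> F r), Re (line_point_t \<xi> F r)]"

definition south :: "real^3" where
  "south = vector [0, 0, -1]"

text \<open>The coordinates \<open>(\<xi>, F)\<close> of an oriented line, meaningful away from the South pole direction
  (see \<open>line_coords_ex1\<close>).\<close>
definition line_coords :: "oline \<Rightarrow> complex \<times> complex" where
  "line_coords l = (THE (\<xi>, F). \<forall>r. line_point \<xi> F r = fst l + r *\<^sub>R snd l)"

definition d_nu :: "(complex \<Rightarrow> complex) \<Rightarrow> complex \<Rightarrow> complex" where
  "d_nu f \<nu> = (frechet_derivative f (at \<nu>) 1 - \<i> * frechet_derivative f (at \<nu>) \<i>) / 2"

definition d_nubar :: "(complex \<Rightarrow> complex) \<Rightarrow> complex \<Rightarrow> complex" where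
  "d_nubar f \<nu> = (frechet_derivative f (at \<nu>) 1 + \<i> * frechet_derivative f (at \<nu>) \<i>) / 2"

text \<open>In what follows \<open>\<xi>\<close> and \<open>F\<close> are functions of the parameter \<open>\<nu>\<close>.\<close>

definition d_plus :: "(complex \<Rightarrow> complex) \<Rightarrow> (complex \<Rightarrow> complex) \<Rightarrow> complex \<Rightarrow> real \<Rightarrow> complex" where
  "d_plus \<xi> F \<nu> r = d_nu F \<nu> + of_real r * d_nu \<xi> \<nu>
     - 2 * F \<nu> * cnj (\<xi> \<nu>) * d_nu \<xi> \<nu> / (1 + \<xi> \<nu> * cnj (\<xi> \<nu>))"

definition d_minus :: "(complex \<Rightarrow> complex) \<Rightarrow> (complex \<Rightarrow> complex) \<Rightarrow> complex \<Rightarrow> real \<Rightarrow> complex" where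
  "d_minus \<xi> F \<nu> r = d_nubar F \<nu> + of_real r * d_nubar \<xi> \<nu>
     - 2 * F \<nu> * cnj (\<xi> \<nu>) * d_nubar \<xi> \<nu> / (1 + \<xi> \<nu> * cnj (\<xi> \<nu>))"

definition Delta :: "(complex \<Rightarrow> complex) \<Rightarrow> (complex \<Rightarrow> complex) \<Rightarrow> complex \<Rightarrow> real \<Rightarrow> complex" where
  "Delta \<xi> F \<nu> r = 4 / (1 + \<xi> \<nu> * cnj (\<xi> \<nu>))\<^sup>2 *
     (d_plus \<xi> F \<nu> r * cnj (d_plus \<xi> F \<nu> r) - d_minus \<xi> F \<nu> r * cnj (d_minus \<xi> F \<nu> r))"

definition opt_rho :: "(complex \<Rightarrow> complex) \<Rightarrow> (complex \<Rightarrow> complex) \<Rightarrow> complex \<Rightarrow> real \<Rightarrow> complex" where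
  "opt_rho \<xi> F \<nu> r =
     (d_plus \<xi> F \<nu> r * d_nubar (cnj \<circ> \<xi>) \<nu> - d_minus \<xi> F \<nu> r * d_nu (cnj \<circ> \<xi>) \<nu>) /
     (d_minus \<xi> F \<nu> r * cnj (d_minus \<xi> F \<nu> r) - d_plus \<xi> F \<nu> r * cnj (d_plus \<xi> F \<nu> r))"

definition opt_sigma :: "(complex \<Rightarrow> complex) \<Rightarrow> (complex \<Rightarrow> complex) \<Rightarrow> complex \<Rightarrow> real \<Rightarrow> complex" where
  "opt_sigma \<xi> F \<nu> r =
     (cnj (d_plus \<xi> F \<nu> r) * d_nu (cnj \<circ> \<xi>) \<nu> - cnj (d_minus \<xi> F \<nu> r) * d_nubar (cnj \<circ> \<xi>) \<nu>) /
     (d_minus \<xi> F \<nu> r * cnj (d_minus \<xi> F \<nu> r) - d_plus \<xi> F \<nu> r * cnj (d_plus \<xi> F \<nu> r))"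

definition curvature :: "(complex \<Rightarrow> complex) \<Rightarrow> (complex \<Rightarrow> complex) \<Rightarrow> complex \<Rightarrow> real \<Rightarrow> complex" where
  "curvature \<xi> F \<nu> r =
     opt_rho \<xi> F \<nu> r * cnj (opt_rho \<xi> F \<nu> r) - opt_sigma \<xi> F \<nu> r * cnj (opt_sigma \<xi> F \<nu> r)"

definition param_curvature_nonzero :: "(complex \<Rightarrow> oline) \<Rightarrow> complex \<Rightarrow> bool" where
  "param_curvature_nonzero g \<nu> \<longleftrightarrow>
     (let \<xi> = fst \<circ> line_coords \<circ> g; F = snd \<circ> line_coords \<circ> g in
       (\<exists>r. Delta \<xi> F \<nu> r \<noteq> 0) \<and> (\<forall>r. Delta \<xi> F \<nu> r \<noteq> 0 \<longrightarrow> curvature \<xi> F \<nu> r \<noteq> 0))"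

definition rotate_line :: "real^3^3 \<Rightarrow> oline \<Rightarrow> oline" where
  "rotate_line Q l = (Q *v fst l, Q *v snd l)"

text \<open>A line in the South pole direction has no coordinates \<open>(\<xi>, F)\<close>; the congruence is first
  rotated by any rotation that moves its direction away from the South pole.\<close>
definition curvature_nonzero_at ::
    "('m set \<times> ('m \<Rightarrow> complex)) set \<Rightarrow> ('m \<Rightarrow> oline) \<Rightarrow> 'm \<Rightarrow> bool" where
  "curvature_nonzero_at A f m \<longleftrightarrow>
     (\<forall>(U, \<phi>)\<in>A. m \<in> U \<longrightarrow>
        (if line_dir (f m) \<noteq> south
         then param_curvature_nonzero (f \<circ> inv_into U \<phi>) (\<phi> m)
         else \<forall>Q. rotation_matrix Q \<and> Q *v line_dir (f m) \<noteq> south \<longrightarrow>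
                param_curvature_nonzero (rotate_line Q \<circ> f \<circ> inv_into U \<phi>) (\<phi> m)))"

lemma one_plus_norm_nonzero: "1 + \<xi> * cnj \<xi> \<noteq> 0"
proof -
  have "1 + \<xi> * cnj \<xi> = of_real (1 + (norm \<xi>)\<^sup>2)"
    using complex_norm_square[of \<xi>] by simp
  moreover have "1 + (norm \<xi>)\<^sup>2 \<noteq> 0"
    using zero_le_power2[of "norm \<xi>"] by linarith
  ultimately show ?thesis
    by (metis of_real_eq_0_iff)
qed

lemma line_point_z_affine:
  "line_point_z \<xi> F r = line_point_z \<xi> F 0 + of_real r * (2 * \<xi> / (1 + \<xi> * cnj \<xi>))"
  using one_plus_norm_nonzero[of \<xi>]
  by (simp add: line_point_z_def add_divide_distrib power2_eq_square)

lemma line_point_t_affine: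
  "line_point_t \<xi> F r =
     line_point_t \<xi> F 0 + of_real r * ((1 - \<xi> * cnj \<xi>) / (1 + \<xi> * cnj \<xi>))"
proof -
  have "1 - \<xi>\<^sup>2 * (cnj \<xi>)\<^sup>2 = (1 - \<xi> * cnj \<xi>) * (1 + \<xi> * cnj \<xi>)"
    by (simp add: algebra_simps power2_eq_square)
  then show ?thesis
    using one_plus_norm_nonzero[of \<xi>]
    by (simp add: line_point_t_def add_divide_distrib power2_eq_square)
qed

lemma line_point_t_real: "of_real (Re (line_point_t \<xi> F r)) = line_point_t \<xi> F r"
proof -
  have "cnj (line_point_t \<xi> F r) = line_point_t \<xi> F r"
    by (simp add: line_point_t_def algebra_simps)
  then show ?thesis
    by (metis Reals_cnj_iff of_real_Re)
qed

lemma line_incidence: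
  assumes "Z = line_point_z \<xi> F 0" "T = line_point_t \<xi> F 0"
  shows "F = (Z - 2 * T * \<xi> - cnj Z * \<xi>\<^sup>2) / 2"
proof -
  let ?k = "cnj \<xi>"
  let ?N = "1 + \<xi> * ?k"
  have N: "?N \<noteq> 0" by (rule one_plus_norm_nonzero)
  have Z: "Z * ?N\<^sup>2 = 2 * (F - cnj F * \<xi>\<^sup>2)"
    using N assms by (simp add: line_point_z_def)
  have T: "T * ?N\<^sup>2 = - 2 * (F * ?k + cnj F * \<xi>)"
    using N assms by (simp add: line_point_t_def)
  have Zc: "cnj Z * ?N\<^sup>2 = 2 * (cnj F - F * ?k\<^sup>2)"
    using arg_cong[OF Z, of cnj] by (simp add: mult.commute)
  have "(Z - 2 * T * \<xi> - cnj Z * \<xi>\<^sup>2) * ?N\<^sup>2 = Z * ?N\<^sup>2 - 2 * (T * ?N\<^sup>2) * \<xi> - (cnj Z * ?N\<^sup>2) * \<xi>\<^sup>2"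
    by (simp add: algebra_simps)
  also have "\<dots> = (2 * F) * ?N\<^sup>2"
    unfolding Z T Zc by (simp add: algebra_simps power2_eq_square)
  finally show ?thesis
    using N by simp
qed

lemma line_coords_ex1:
  assumes "l \<in> oriented_lines" "line_dir l \<noteq> south"
  shows "\<exists>!(\<xi>, F). \<forall>r. line_point \<xi> F r = fst l + r *\<^sub>R snd l"
proof -
  obtain U W where l: "l = (U, W)" by force
  define Z T V c where "Z = Complex (U$1) (U$2)" and "T = complex_of_real (U$3)"
    and "V = Complex (W$1) (W$2)" and "c = complex_of_real (W$3)"
  have norm1: "(W$1)\<^sup>2 + (W$2)\<^sup>2 + (W$3)\<^sup>2 = 1" and orth: "U$1 * W$1 + U$2 * W$2 + U$3 * W$3 = 0"
    using assms(1) unfolding oriented_lines_def l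
    by (auto simp: norm_eq_1 inner_vec_def sum_3 power2_eq_square)
  have "W$3 \<noteq> -1"
  proof
    assume "W$3 = -1"
    then have "W$1 = 0 \<and> W$2 = 0" using norm1 by (simp add: sum_power2_eq_zero_iff)
    with \<open>W$3 = -1\<close> have "W = south" by (simp add: vec_eq_iff forall_3 south_def)
    then show False using assms(2) l by simp
  qed
  then have c1: "1 + c \<noteq> 0"
    unfolding c_def by (metis add_eq_0_iff minus_minus of_real_1 of_real_eq_iff of_real_minus)
  have VV: "V * cnj V = 1 - c\<^sup>2"
    using norm1 by (simp add: V_def c_def complex_eq_iff power2_eq_square algebra_simps)
  have cc: "cnj c = c" "cnj T = T" by (simp_all add: c_def T_def)
  have ZV: "Z * cnj V + cnj Z * V = - 2 * T * c"
    using orth by (simp add: Z_def V_def T_def c_def complex_eq_iff algebra_simps)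
  have eq_iff: "(\<forall>r. line_point \<xi> F r = fst l + r *\<^sub>R snd l) \<longleftrightarrow>
      line_point_z \<xi> F 0 = Z \<and> line_point_t \<xi> F 0 = T \<and>
      2 * \<xi> / (1 + \<xi> * cnj \<xi>) = V \<and> (1 - \<xi> * cnj \<xi>) / (1 + \<xi> * cnj \<xi>) = c"
    (is "?P \<longleftrightarrow> ?Q") for \<xi> F
  proof -
    have pt: "line_point \<xi> F r = fst l + r *\<^sub>R snd l \<longleftrightarrow>
        line_point_z \<xi> F r = Z + of_real r * V \<and> line_point_t \<xi> F r = T + of_real r * c" for r
    proof -
      have "line_point_t \<xi> F r = T + of_real r * c \<longleftrightarrow> Re (line_point_t \<xi> F r) = U$3 + r * W$3"
        unfolding T_def c_def
        by (subst line_point_t_real[symmetric])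
           (simp only: of_real_add[symmetric] of_real_mult[symmetric] of_real_eq_iff)
      then show ?thesis
        by (simp add: l vec_eq_iff forall_3 line_point_def Z_def V_def complex_eq_iff)
    qed
    show ?thesis
    proof
      assume P: ?P
      have 0: "line_point_z \<xi> F 0 = Z" "line_point_t \<xi> F 0 = T"
        using P[rule_format, of 0] pt[of 0] by auto
      have "line_point_z \<xi> F 1 = Z + V" "line_point_t \<xi> F 1 = T + c"
        using P[rule_format, of 1] pt[of 1] by auto
      then show ?Q
        using 0 line_point_z_affine[of \<xi> F 1] line_point_t_affine[of \<xi> F 1] by simp
    next
      assume Q: ?Q
      show ?P
      proof
        fix r
        show "line_point \<xi> F r = fst l + r *\<^sub>R snd l"
          unfolding pt using Q
          by (subst line_point_z_affine, subst line_point_t_affine) simp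
      qed
    qed
  qed
  define \<xi>0 where "\<xi>0 = V / (1 + c)"
  define F0 where "F0 = (Z - 2 * T * \<xi>0 - cnj Z * \<xi>0\<^sup>2) / 2"
  let ?N = "1 + \<xi>0 * cnj \<xi>0"
  have N: "?N \<noteq> 0" by (rule one_plus_norm_nonzero)
  have ss: "\<xi>0 * cnj \<xi>0 * (1 + c) = 1 - c"
  proof -
    have "\<xi>0 * cnj \<xi>0 * (1 + c) = (1 - c\<^sup>2) / (1 + c)"
      using c1 VV by (simp add: \<xi>0_def cc)
    also have "\<dots> = 1 - c"
      using c1 by (simp add: divide_simps power2_eq_square algebra_simps)
    finally show ?thesis .
  qed
  have N2: "?N * (1 + c) = 2" using ss by (simp add: algebra_simps)
  have V0: "V = \<xi>0 * (1 + c)" using c1 by (simp add: \<xi>0_def)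
  have dirV: "2 * \<xi>0 / ?N = V"
    using N N2 by (simp add: V0 divide_simps) (metis mult.assoc mult.commute)
  have dirc: "(1 - \<xi>0 * cnj \<xi>0) / ?N = c"
    using N ss by (simp add: divide_simps) (simp add: algebra_simps)
  have con: "T * (1 - \<xi>0 * cnj \<xi>0) = - (Z * cnj \<xi>0 + cnj Z * \<xi>0)"
  proof -
    have "1 - \<xi>0 * cnj \<xi>0 = c * ?N" using N dirc by (simp add: divide_simps)
    then have "T * (1 - \<xi>0 * cnj \<xi>0) * (1 + c) = T * c * (?N * (1 + c))" by (simp add: mult.assoc)
    also have "\<dots> = - (Z * cnj V + cnj Z * V)" by (simp add: N2 ZV)
    also have "\<dots> = - (Z * cnj \<xi>0 + cnj Z * \<xi>0) * (1 + c)"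
      by (simp add: V0 cc algebra_simps)
    finally show ?thesis using c1 mult_right_cancel by blast
  qed
  have F0c: "cnj F0 = (cnj Z - 2 * T * cnj \<xi>0 - Z * (cnj \<xi>0)\<^sup>2) / 2"
    by (simp add: F0_def cc)
  have z0: "line_point_z \<xi>0 F0 0 = Z"
  proof -
    have "2 * (F0 - cnj F0 * \<xi>0\<^sup>2) = Z * (1 + (\<xi>0 * cnj \<xi>0)\<^sup>2) - 2 * cnj Z * \<xi>0\<^sup>2
        - 2 * \<xi>0 * (T * (1 - \<xi>0 * cnj \<xi>0))"
      unfolding F0c unfolding F0_def by (simp add: field_simps power2_eq_square)
    also have "\<dots> = Z * ?N\<^sup>2"
      unfolding con by (simp add: algebra_simps power2_eq_square)
    finally show ?thesis using N by (simp add: line_point_z_def)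
  qed
  have t0: "line_point_t \<xi>0 F0 0 = T"
  proof -
    have "- 2 * (F0 * cnj \<xi>0 + cnj F0 * \<xi>0) =
        - (Z * cnj \<xi>0 + cnj Z * \<xi>0) * (1 - \<xi>0 * cnj \<xi>0) + 4 * T * (\<xi>0 * cnj \<xi>0)"
      unfolding F0c unfolding F0_def by (simp add: field_simps power2_eq_square)
    also have "\<dots> = T * ?N\<^sup>2"
      unfolding con[symmetric] by (simp add: algebra_simps power2_eq_square)
    finally show ?thesis using N by (simp add: line_point_t_def)
  qed
  have ex: "\<forall>r. line_point \<xi>0 F0 r = fst l + r *\<^sub>R snd l"
    using eq_iff z0 t0 dirV dirc by blast
  have uniq: "\<xi> = \<xi>0 \<and> F = F0" if "\<forall>r. line_point \<xi> F r = fst l + r *\<^sub>R snd l" for \<xi> F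
  proof -
    have Q: "line_point_z \<xi> F 0 = Z" "line_point_t \<xi> F 0 = T"
      "2 * \<xi> / (1 + \<xi> * cnj \<xi>) = V" "(1 - \<xi> * cnj \<xi>) / (1 + \<xi> * cnj \<xi>) = c"
      using that eq_iff by blast+
    have M: "1 + \<xi> * cnj \<xi> \<noteq> 0" by (rule one_plus_norm_nonzero)
    have "1 + c = 2 / (1 + \<xi> * cnj \<xi>)"
      unfolding Q(4)[symmetric] using M by (simp add: divide_simps)
    then have "V = \<xi> * (1 + c)" using Q(3) by (simp add: mult.commute)
    then have xi: "\<xi> = \<xi>0" using c1 by (simp add: \<xi>0_def)
    then show ?thesis using line_incidence[OF Q(1)[symmetric] Q(2)[symmetric]] by (simp add: F0_def)
  qed
  show ?thesis
  proof (rule ex1I[of _ "(\<xi>0, F0)"])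
    show "case (\<xi>0, F0) of (\<xi>, F) \<Rightarrow> \<forall>r. line_point \<xi> F r = fst l + r *\<^sub>R snd l"
      unfolding prod.case by (rule ex)
  next
    fix p assume "case p of (\<xi>, F) \<Rightarrow> \<forall>r. line_point \<xi> F r = fst l + r *\<^sub>R snd l"
    then have "\<forall>r. line_point (fst p) (snd p) r = fst l + r *\<^sub>R snd l"
      unfolding case_prod_beta .
    from uniq[OF this] show "p = (\<xi>0, F0)"
      by (metis prod.collapse)
  qed
qed

end

theory Submission
  imports Defs
begin

text \<open>Write \<open>g\<close> for the congruence in a chart and \<open>W = line_dir \<circ> g\<close> for its direction. Both sides
  of the theorem say at every point that the derivative of \<open>W\<close> is injective, that is, that the
  congruence is transverse to the fibres of the projection to the sphere.

  \<^emph>\<open>Curvature.\<close> Let \<open>J\<close> be the Jacobian of \<open>\<xi>\<close>. An algebraic identity gives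
  \<open>K = J / (\<partial>\<^sup>+F cnj (\<partial>\<^sup>+F) - \<partial>\<^sup>-F cnj (\<partial>\<^sup>-F))\<close>, and the denominator, which is \<open>\<Delta>\<close> up to a positive
  factor, is a polynomial in \<open>r\<close> whose coefficient of \<open>r\<^sup>2\<close> is \<open>J\<close>. Hence the curvature is
  non-zero if and only if \<open>J \<noteq> 0\<close> (\<open>curvature_nonzero_iff_jac\<close>). As \<open>\<xi>\<close> is the stereographic
  coordinate of \<open>W\<close>, this is injectivity of the derivative of \<open>W\<close>, a condition that is invariant
  under rotations (\<open>param_curvature_nonzero_iff\<close>, \<open>rotated_curvature_nonzero_iff\<close>).

  \<^emph>\<open>Graphs.\<close> If \<open>g\<close> parametrises the graph of a section \<open>s\<close>, then \<open>g = s \<circ> W\<close>, and since \<open>g\<close> is an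
  immersion so is \<open>W\<close> (\<open>direction_immersive_if_graph\<close>). Conversely, if the derivative of \<open>W\<close> is
  injective then \<open>W\<close> has a smooth local inverse into the parameter plane, and composing it with \<open>g\<close>
  gives the section (\<open>graph_if_direction_immersive\<close>). That inverse is smooth, and not only
  differentiable, by \<open>smooth_local_inverse\<close>, which rests on the closure of \<open>C\<^sup>k\<close> maps under
  products, reciprocals and composition.\<close>

section \<open>Calculus of smooth maps\<close>

lemma Ck_on_cong:
  assumes "open S" "\<And>x. x \<in> S \<Longrightarrow> f x = g x" "Ck_on k f S"
  shows "Ck_on k g S"
  using assms(2,3)
proof (induction k arbitrary: f g)
  case 0
  then show ?case by (auto cong: continuous_on_cong)
next
  case (Suc k)
  have d: "(g has_derivative frechet_derivative f (at x)) (at x)" if "x \<in> S" for x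
    using Suc.prems that assms(1)
    by (metis Ck_on.simps(2) frechet_derivative_works has_derivative_transform_within_open)
  then have "frechet_derivative f (at x) v = frechet_derivative g (at x) v" if "x \<in> S" for x v
    using frechet_derivative_at that by metis
  then have "Ck_on k (\<lambda>x. frechet_derivative g (at x) v) S" for v
    by (rule Suc.IH) (use Suc.prems in auto)
  then show ?case using d by (auto simp: differentiable_def)
qed

text \<open>On an open set the recursive definition of \<open>C\<^sup>k\<close> may be checked with any explicit
  formula for the derivative; the closure properties under linear and
  bilinear operations, reciprocals and composition are all obtained in this way.\<close>
lemma Ck_on_SucI:
  assumes "open S" "\<And>x. x \<in> S \<Longrightarrow> (f has_derivative f' x) (at x)"
    "\<And>v. Ck_on k (\<lambda>x. f' x v) S"
  shows "Ck_on (Suc k) f S"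
proof -
  have "f' x v = frechet_derivative f (at x) v" if "x \<in> S" for x v
    using frechet_derivative_at[OF assms(2)[OF that]] by simp
  then have "Ck_on k (\<lambda>x. frechet_derivative f (at x) v) S" for v
    by (intro Ck_on_cong[OF assms(1) _ assms(3)])
  then show ?thesis using assms(2) by (auto simp: differentiable_def)
qed

lemma Ck_on_has_derivative:
  "Ck_on (Suc k) f S \<Longrightarrow> x \<in> S \<Longrightarrow> (f has_derivative frechet_derivative f (at x)) (at x)"
  by (simp add: frechet_derivative_works)

lemma Ck_on_Suc_imp: "Ck_on (Suc k) f S \<Longrightarrow> Ck_on k f S"
proof (induction k arbitrary: f)
  case 0
  then show ?case
    by (auto intro!: continuous_at_imp_continuous_on differentiable_imp_continuous_within)
next
  case (Suc k)
  then show ?case by (metis Ck_on.simps(2))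
qed

lemma Ck_on_subset: "Ck_on k f S \<Longrightarrow> T \<subseteq> S \<Longrightarrow> Ck_on k f T"
  by (induction k arbitrary: f) (auto intro: continuous_on_subset)

lemma Ck_on_const: "open S \<Longrightarrow> Ck_on k (\<lambda>x. c) S"
proof (induction k arbitrary: c)
  case (Suc k)
  show ?case by (rule Ck_on_SucI[where f' = "\<lambda>x v. 0"]) (use Suc in auto)
qed auto

lemma Ck_on_linear:
  assumes "bounded_linear L" "open S" "Ck_on k f S"
  shows "Ck_on k (\<lambda>x. L (f x)) S"
  using assms(3)
proof (induction k arbitrary: f)
  case 0
  then show ?case using assms(1) by (auto intro: bounded_linear.continuous_on)
next
  case (Suc k)
  show ?case
    by (rule Ck_on_SucI[OF assms(2), where f' = "\<lambda>x v. L (frechet_derivative f (at x) v)"])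
       (use Suc in \<open>auto intro!: bounded_linear.has_derivative[OF assms(1)]
          simp: frechet_derivative_works[symmetric]\<close>)
qed

lemma Ck_on_id: "open S \<Longrightarrow> Ck_on k (\<lambda>x. x) S"
proof (cases k)
  case (Suc j)
  assume "open S"
  then show ?thesis
    unfolding Suc by (intro Ck_on_SucI[where f' = "\<lambda>x v. v"] Ck_on_const) auto
qed simp

lemma Ck_on_add:
  assumes "open S" "Ck_on k f S" "Ck_on k g S"
  shows "Ck_on k (\<lambda>x. f x + g x) S"
  using assms(2,3)
proof (induction k arbitrary: f g)
  case (Suc k)
  show ?case
    by (rule Ck_on_SucI[OF assms(1), where
          f' = "\<lambda>x v. frechet_derivative f (at x) v + frechet_derivative g (at x) v"])
       (use Suc in \<open>auto intro!: has_derivative_add simp: frechet_derivative_works[symmetric]\<close>)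
qed (auto intro: continuous_on_add)

lemma Ck_on_sum:
  "finite I \<Longrightarrow> open S \<Longrightarrow> (\<And>i. i \<in> I \<Longrightarrow> Ck_on k (f i) S) \<Longrightarrow> Ck_on k (\<lambda>x. \<Sum>i\<in>I. f i x) S"
  by (induction I rule: finite_induct) (auto intro: Ck_on_const Ck_on_add)

lemma Ck_on_bilinear:
  assumes "bounded_bilinear B" "open S" "Ck_on k f S" "Ck_on k g S"
  shows "Ck_on k (\<lambda>x. B (f x) (g x)) S"
  using assms(3,4)
proof (induction k arbitrary: f g)
  case 0
  then show ?case using assms(1) by (auto intro: bounded_bilinear.continuous_on)
next
  case (Suc k)
  let ?D = "\<lambda>x v. B (f x) (frechet_derivative g (at x) v) + B (frechet_derivative f (at x) v) (g x)"
  have "Ck_on k (\<lambda>x. ?D x v) S" for v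
    by (intro Ck_on_add assms(2) Suc.IH) (use Suc.prems in \<open>auto intro: Ck_on_Suc_imp\<close>)
  moreover have "((\<lambda>x. B (f x) (g x)) has_derivative ?D x) (at x)" if "x \<in> S" for x
    using Suc.prems that
    by (intro bounded_bilinear.FDERIV[OF assms(1)] Ck_on_has_derivative)
  ultimately show ?case by (intro Ck_on_SucI[OF assms(2), where f' = ?D])
qed

lemma Ck_on_inverse:
  fixes f :: "'a::real_normed_vector \<Rightarrow> 'b::real_normed_field"
  assumes "open S" "\<And>x. x \<in> S \<Longrightarrow> f x \<noteq> 0" "Ck_on k f S"
  shows "Ck_on k (\<lambda>x. inverse (f x)) S"
  using assms(3)
proof (induction k)
  case 0
  then show ?case using assms(2) by (auto intro: continuous_on_inverse)
next
  case (Suc k)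
  let ?D = "\<lambda>x v. (-1) * ((inverse (f x) * frechet_derivative f (at x) v) * inverse (f x))"
  have "Ck_on k (\<lambda>x. inverse (f x)) S"
    using Suc by (blast intro: Ck_on_Suc_imp)
  then have "Ck_on k (\<lambda>x. ?D x v) S" for v
    by (intro Ck_on_bilinear[OF bounded_bilinear_mult assms(1)] Ck_on_const assms(1))
       (use Suc.prems in auto)
  moreover have "((\<lambda>x. inverse (f x)) has_derivative ?D x) (at x)" if "x \<in> S" for x
  proof -
    have "(f has_derivative frechet_derivative f (at x)) (at x)"
      using Suc.prems that by (rule Ck_on_has_derivative)
    from Deriv.has_derivative_inverse[OF assms(2)[OF that] this] show ?thesis by simp
  qed
  ultimately show ?case by (intro Ck_on_SucI[OF assms(1), where f' = ?D])
qed

text \<open>The directional derivative of \<open>f \<circ> g\<close> is not a directional derivative of \<open>f\<close> in a fixed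
  direction, so it is expanded in the coordinates of the direction \<open>Dg v\<close>.\<close>
lemma Ck_on_compose:
  fixes f :: "'b::euclidean_space \<Rightarrow> 'c::real_normed_vector"
  assumes "open S" "open T" "g ` S \<subseteq> T" "Ck_on k f T" "Ck_on k g S"
  shows "Ck_on k (\<lambda>x. f (g x)) S"
  using assms(4,5)
proof (induction k arbitrary: f)
  case 0
  then show ?case using assms(3) continuous_on_compose2 by fastforce
next
  case (Suc k)
  let ?D = "\<lambda>x v. frechet_derivative f (at (g x)) (frechet_derivative g (at x) v)"
  let ?E = "\<lambda>x v. \<Sum>b\<in>Basis. (frechet_derivative g (at x) v \<bullet> b) *\<^sub>R frechet_derivative f (at (g x)) b"
  have df: "(f has_derivative frechet_derivative f (at (g x))) (at (g x))" if "x \<in> S" for x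
    using Suc.prems(1) that assms(3) by (intro Ck_on_has_derivative) auto
  have "((\<lambda>x. f (g x)) has_derivative ?D x) (at x)" if "x \<in> S" for x
    using has_derivative_compose[OF Ck_on_has_derivative[OF Suc.prems(2) that] df[OF that]] .
  moreover have "Ck_on k (\<lambda>x. ?D x v) S" for v
  proof (rule Ck_on_cong[OF assms(1), of "\<lambda>x. ?E x v"])
    fix x assume "x \<in> S"
    then have "linear (frechet_derivative f (at (g x)))"
      using df has_derivative_linear by blast
    then have "?E x v = frechet_derivative f (at (g x)) (\<Sum>b\<in>Basis. (frechet_derivative g (at x) v \<bullet> b) *\<^sub>R b)"
      by (simp add: linear_sum linear_scale)
    then show "?E x v = ?D x v" by (simp add: euclidean_representation)
  next
    have "Ck_on k (\<lambda>x. frechet_derivative f (at (g x)) b) S" for b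
      using Suc.prems by (intro Suc.IH) (auto intro: Ck_on_Suc_imp)
    moreover have "Ck_on k (\<lambda>x. frechet_derivative g (at x) v \<bullet> b) S" for b
      using Suc.prems by (intro Ck_on_linear[OF bounded_linear_inner_left] assms(1)) auto
    ultimately show "Ck_on k (\<lambda>x. ?E x v) S"
      by (intro Ck_on_sum Ck_on_bilinear[OF bounded_bilinear_scaleR] assms(1)) auto
  qed
  ultimately show ?case by (intro Ck_on_SucI[OF assms(1), where f' = ?D])
qed

lemma smooth_on_compose:
  fixes f :: "'b::euclidean_space \<Rightarrow> 'c::real_normed_vector"
  assumes "open S" "open T" "g ` S \<subseteq> T" "smooth_on T f" "smooth_on S g"
  shows "smooth_on S (\<lambda>x. f (g x))"
  using assms unfolding smooth_on_def by (blast intro: Ck_on_compose)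

lemma smooth_on_linear:
  "bounded_linear L \<Longrightarrow> open S \<Longrightarrow> smooth_on S f \<Longrightarrow> smooth_on S (\<lambda>x. L (f x))"
  unfolding smooth_on_def by (blast intro: Ck_on_linear)

lemma smooth_on_has_derivative:
  "smooth_on S f \<Longrightarrow> x \<in> S \<Longrightarrow> (f has_derivative frechet_derivative f (at x)) (at x)"
  unfolding smooth_on_def using Ck_on_has_derivative by blast

lemma smooth_on_directional:
  "smooth_on S f \<Longrightarrow> smooth_on S (\<lambda>x. frechet_derivative f (at x) v)"
  unfolding smooth_on_def using Ck_on.simps(2) by blast

lemma smooth_on_imp_continuous_on: "smooth_on S f \<Longrightarrow> continuous_on S f"
  unfolding smooth_on_def using Ck_on.simps(1) by blast

lemma smooth_on_subset: "smooth_on S f \<Longrightarrow> T \<subseteq> S \<Longrightarrow> smooth_on T f"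
  unfolding smooth_on_def by (blast intro: Ck_on_subset)

section \<open>Real-linear maps of the complex plane and smooth local inverses\<close>

text \<open>The Jacobian determinant of the real derivative of \<open>f\<close>, kept complex to match the type of
  the curvature.\<close>
definition jac :: "(complex \<Rightarrow> complex) \<Rightarrow> complex \<Rightarrow> complex" where
  "jac f \<nu> = d_nu f \<nu> * cnj (d_nu f \<nu>) - d_nubar f \<nu> * cnj (d_nubar f \<nu>)"

lemma linear_complex_basis:
  fixes D :: "complex \<Rightarrow> 'a::real_vector"
  assumes "linear D"
  shows "D v = Re v *\<^sub>R D 1 + Im v *\<^sub>R D \<i>"
proof -
  have "v = Re v *\<^sub>R 1 + Im v *\<^sub>R \<i>" by (simp add: complex_eq_iff)
  then have "D v = D (Re v *\<^sub>R 1 + Im v *\<^sub>R \<i>)" by (rule arg_cong)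
  then show ?thesis unfolding linear_add[OF assms] linear_scale[OF assms] .
qed

lemma derivative_eq_d_nu:
  assumes "(f has_derivative D) (at \<nu>)"
  shows "D v = d_nu f \<nu> * v + d_nubar f \<nu> * cnj v"
proof -
  have D: "frechet_derivative f (at \<nu>) = D"
    using frechet_derivative_at[OF assms] by simp
  have "D v = Re v *\<^sub>R D 1 + Im v *\<^sub>R D \<i>"
    using assms by (intro linear_complex_basis has_derivative_linear)
  then show ?thesis
    by (simp add: d_nu_def d_nubar_def D complex_eq_iff field_simps)
qed

text \<open>Cramer's rule for the real-linear map \<open>v \<mapsto> p v + q cnj v\<close>, whose adjugate is
  \<open>z \<mapsto> cnj p z - q cnj z\<close> and whose determinant is \<open>p cnj p - q cnj q\<close>.\<close>
lemma real_linear_adjugate: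
  fixes p q z :: complex
  shows "p * (cnj p * z - q * cnj z) + q * cnj (cnj p * z - q * cnj z) = (p * cnj p - q * cnj q) * z"
  by (simp add: algebra_simps)

text \<open>If the determinant vanishes, the adjugate maps into the kernel; it can only map to \<open>0\<close> when
  the derivative itself is \<open>0\<close>. If it does not vanish, applying the adjugate to \<open>D v\<close>
  recovers a nonzero multiple of \<open>v\<close>.\<close>
lemma inj_derivative_iff_jac:
  assumes "(f has_derivative D) (at \<nu>)"
  shows "inj D \<longleftrightarrow> jac f \<nu> \<noteq> 0"
proof -
  let ?p = "d_nu f \<nu>" and ?q = "d_nubar f \<nu>"
  have lin: "linear D" using assms has_derivative_linear by blast
  have D: "D v = ?p * v + ?q * cnj v" for v using derivative_eq_d_nu[OF assms] .
  have inj: "inj D \<longleftrightarrow> (\<forall>v. D v = 0 \<longrightarrow> v = 0)" using linear_injective_0[OF lin] .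
  have "\<exists>v. D v = 0 \<and> v \<noteq> 0" if "jac f \<nu> = 0"
  proof (rule ccontr)
    assume "\<not> ?thesis"
    then have no: "D v = 0 \<Longrightarrow> v = 0" for v by blast
    have "D (cnj ?p * z - ?q * cnj z) = 0" for z
      using that unfolding D real_linear_adjugate jac_def by simp
    then have z: "cnj ?p * z - ?q * cnj z = 0" for z using no by blast
    have "?q = cnj ?p" "\<i> * (cnj ?p + ?q) = 0" using z[of 1] z[of \<i>] by (auto simp: algebra_simps)
    then have "cnj ?p = 0" "?q = 0" by auto
    then have "D 1 = 0" unfolding D by simp
    then show False using no by force
  qed
  moreover have "v = 0" if "jac f \<nu> \<noteq> 0" "D v = 0" for v
  proof -
    have "cnj ?p * D v - ?q * cnj (D v) = jac f \<nu> * v"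
      by (simp add: D jac_def algebra_simps)
    then show ?thesis using that by simp
  qed
  ultimately show ?thesis using inj by blast
qed

lemma inv_derivative:
  assumes "(f has_derivative D) (at \<nu>)" "jac f \<nu> \<noteq> 0"
  shows "inv D w = (cnj (d_nu f \<nu>) * w - d_nubar f \<nu> * cnj w) * inverse (jac f \<nu>)"
proof (rule inv_f_eq)
  show "inj D" using inj_derivative_iff_jac assms by blast
  have J: "cnj (jac f \<nu>) = jac f \<nu>" by (simp add: jac_def mult.commute)
  let ?z = "w * inverse (jac f \<nu>)"
  have "(cnj (d_nu f \<nu>) * w - d_nubar f \<nu> * cnj w) * inverse (jac f \<nu>) =
      cnj (d_nu f \<nu>) * ?z - d_nubar f \<nu> * cnj ?z"
    by (simp add: J algebra_simps)
  then show "D ((cnj (d_nu f \<nu>) * w - d_nubar f \<nu> * cnj w) * inverse (jac f \<nu>)) = w"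
    unfolding derivative_eq_d_nu[OF assms(1)]
    using assms(2) by (simp only: real_linear_adjugate) (simp add: jac_def)
qed

lemma Ck_on_mult:
  fixes f g :: "'a::real_normed_vector \<Rightarrow> complex"
  shows "open S \<Longrightarrow> Ck_on k f S \<Longrightarrow> Ck_on k g S \<Longrightarrow> Ck_on k (\<lambda>x. f x * g x) S"
  by (rule Ck_on_bilinear[OF bounded_bilinear_mult])

lemma Ck_on_diff:
  assumes "open S" "Ck_on k f S" "Ck_on k g S"
  shows "Ck_on k (\<lambda>x. f x - g x) S"
  using Ck_on_add[OF assms(1,2) Ck_on_linear[OF bounded_linear_minus[OF bounded_linear_ident] assms(1,3)]]
  by simp

lemma Ck_on_d_nu:
  assumes "open S" "smooth_on S f"
  shows "Ck_on k (d_nu f) S" "Ck_on k (d_nubar f) S"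
proof -
  have 1: "Ck_on k (\<lambda>x. frechet_derivative f (at x) v) S" for v
    using smooth_on_directional[OF assms(2)] unfolding smooth_on_def by blast
  have "Ck_on k (\<lambda>x. (frechet_derivative f (at x) 1 - \<i> * frechet_derivative f (at x) \<i>) * (1/2)) S"
    by (intro Ck_on_mult Ck_on_diff Ck_on_const assms(1) 1)
  then show "Ck_on k (d_nu f) S" by (simp add: d_nu_def[abs_def])
  have "Ck_on k (\<lambda>x. (frechet_derivative f (at x) 1 + \<i> * frechet_derivative f (at x) \<i>) * (1/2)) S"
    by (intro Ck_on_mult Ck_on_add Ck_on_const assms(1) 1)
  then show "Ck_on k (d_nubar f) S" by (simp add: d_nubar_def[abs_def])
qed

lemma Ck_on_jac:
  assumes "open S" "smooth_on S f"
  shows "Ck_on k (jac f) S"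
  unfolding jac_def[abs_def]
  by (intro Ck_on_mult Ck_on_diff Ck_on_linear[OF bounded_linear_cnj] Ck_on_d_nu assms)

text \<open>The inverse is differentiable by the inverse function theorem; its derivative is an explicit
  rational expression in the first derivatives of \<open>P\<close> at the inverse, so each order of
  differentiability of the inverse gives the next one.\<close>
lemma smooth_local_inverse:
  fixes P :: "complex \<Rightarrow> complex"
  assumes "open S" "smooth_on S P" "x \<in> S" "inj (frechet_derivative P (at x))"
  obtains N h where "open N" "x \<in> N" "N \<subseteq> S" "open (P ` N)" "smooth_on (P ` N) h"
    "\<And>y. y \<in> N \<Longrightarrow> h (P y) = y"
proof -
  note der = smooth_on_has_derivative[OF assms(2)]
  define S' where "S' = S \<inter> jac P -` (- {0})"
  have "continuous_on S (jac P)" using Ck_on_jac[OF assms(1,2), of 0] by simp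
  then have "open S'" unfolding S'_def
    using continuous_open_preimage[of S "jac P" "- {0}"] assms(1) by (simp add: open_Compl)
  have "x \<in> S'" using assms(3,4) inj_derivative_iff_jac[OF der] by (simp add: S'_def)
  define D where "D y = Blinfun (frechet_derivative P (at y))" for y
  have D: "blinfun_apply (D y) = frechet_derivative P (at y)" if "y \<in> S" for y
    unfolding D_def using der[OF that] by (simp add: bounded_linear_Blinfun_apply has_derivative_bounded_linear)
  have S'S: "y \<in> S" if "y \<in> S'" for y using that by (simp add: S'_def)
  have contD: "continuous_on S' D"
  proof (rule continuous_on_blinfun_componentwise)
    fix i :: complex
    have "continuous_on S (\<lambda>y. frechet_derivative P (at y) i)"
      using smooth_on_imp_continuous_on[OF smooth_on_directional[OF assms(2)]] .
    then have "continuous_on S' (\<lambda>y. frechet_derivative P (at y) i)"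
      by (rule continuous_on_subset) (auto simp: S'_def)
    then show "continuous_on S' (\<lambda>y. blinfun_apply (D y) i)"
      by (rule continuous_on_eq) (simp add: D S'S)
  qed
  obtain G where "linear G" "G \<circ> frechet_derivative P (at x) = id"
    using linear_injective_left_inverse[OF has_derivative_linear[OF der[OF assms(3)]] assms(4)] by blast
  then have inv: "Blinfun G o\<^sub>L D x = id_blinfun"
    using assms(3)
    by (intro blinfun_eqI) (auto simp: D bounded_linear_Blinfun_apply linear_conv_bounded_linear fun_eq_iff)
  obtain N V h h' where N: "open N" "N \<subseteq> S'" "x \<in> N" "open V" "homeomorphism N V P h"
    and h: "\<And>y. y \<in> V \<Longrightarrow> (h has_derivative h' y) (at y)"
    "\<And>y. y \<in> V \<Longrightarrow> h' y = inv (blinfun_apply (D (h y)))"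
    by (rule inverse_function_theorem[OF \<open>open S'\<close> _ contD \<open>x \<in> S'\<close> inv, of P])
       (use der S'S D in auto)
  have hV: "h ` V \<subseteq> N" and PN: "P ` N = V" and hP: "\<And>y. y \<in> N \<Longrightarrow> h (P y) = y"
    using N(5) unfolding homeomorphism_def by auto
  define R where "R y w = (cnj (d_nu P y) * w - d_nubar P y * cnj w) * inverse (jac P y)" for y w
  have hR: "(h has_derivative R (h y)) (at y)" if "y \<in> V" for y
  proof -
    have "h y \<in> S" "jac P (h y) \<noteq> 0" using that hV N(2) by (auto simp: S'_def)
    then have "h' y = R (h y)"
      using inv_derivative[OF der] by (auto simp: h(2)[OF that] D R_def)
    then show ?thesis using h(1)[OF that] by simp
  qed
  have R: "Ck_on k (\<lambda>y. R y w) N" for k w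
  proof -
    have "smooth_on N P" using assms(2) N(2) S'S by (blast intro: smooth_on_subset)
    then show ?thesis unfolding R_def using N(2)
      by (intro Ck_on_mult Ck_on_diff Ck_on_const Ck_on_inverse Ck_on_linear[OF bounded_linear_cnj]
            Ck_on_jac Ck_on_d_nu N(1)) (auto simp: S'_def)
  qed
  have "Ck_on k h V" for k
  proof (induction k)
    case 0
    then show ?case using N(5) unfolding homeomorphism_def by simp
  next
    case (Suc k)
    show ?case
      by (rule Ck_on_SucI[OF N(4) hR]) (use Ck_on_compose[OF N(4,1) hV R Suc] in auto)
  qed
  then have "smooth_on V h" unfolding smooth_on_def by blast
  with that[OF N(1,3)] show thesis using N(2,4) S'S PN hP by blast
qed

section \<open>Curvature and the Jacobian of the direction\<close>

text \<open>Here \<open>a\<close>, \<open>b\<close> stand for \<open>d_plus\<close>, \<open>d_minus\<close> and \<open>p\<close>, \<open>q\<close> for the derivatives of \<open>\<xi>\<close>. Up to sign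
  and conjugation, the numerators of \<open>\<rho>\<close> and \<open>\<sigma>\<close> are the two coefficients of the composition of
  \<open>v \<mapsto> a v + b cnj v\<close> with the adjugate of \<open>v \<mapsto> p v + q cnj v\<close>. So the curvature is the product of
  the two determinants \<open>- E\<close> and \<open>p cnj p - q cnj q\<close>, divided by \<open>E\<^sup>2\<close>.\<close>
lemma norm_determinant_identity:
  fixes a b p q :: complex
  assumes "b * cnj b - a * cnj a \<noteq> 0"
  defines "E \<equiv> b * cnj b - a * cnj a"
  shows "((a * cnj p - b * cnj q) / E) * cnj ((a * cnj p - b * cnj q) / E)
       - ((cnj a * cnj q - cnj b * cnj p) / E) * cnj ((cnj a * cnj q - cnj b * cnj p) / E)
       = - (p * cnj p - q * cnj q) / E"
proof -
  have E: "cnj E = E" "E \<noteq> 0" using assms(1) by (simp_all add: E_def mult.commute)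
  have "(a * cnj p - b * cnj q) * (cnj a * p - cnj b * q)
      - (cnj a * cnj q - cnj b * cnj p) * (a * q - b * p) = - (p * cnj p - q * cnj q) * E"
    by (simp add: E_def algebra_simps)
  then show ?thesis using E by (simp add: divide_simps)
qed

lemma d_nu_cnj:
  assumes "f differentiable (at \<nu>)"
  shows "d_nu (cnj \<circ> f) \<nu> = cnj (d_nubar f \<nu>)" "d_nubar (cnj \<circ> f) \<nu> = cnj (d_nu f \<nu>)"
proof -
  have "(f has_derivative frechet_derivative f (at \<nu>)) (at \<nu>)"
    using assms by (simp add: frechet_derivative_works)
  from bounded_linear.has_derivative[OF bounded_linear_cnj this]
  have "frechet_derivative (cnj \<circ> f) (at \<nu>) = (\<lambda>v. cnj (frechet_derivative f (at \<nu>) v))"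
    unfolding comp_def by (rule frechet_derivative_at[symmetric])
  then show "d_nu (cnj \<circ> f) \<nu> = cnj (d_nubar f \<nu>)" "d_nubar (cnj \<circ> f) \<nu> = cnj (d_nu f \<nu>)"
    by (simp_all add: d_nu_def d_nubar_def)
qed

text \<open>Let \<open>E\<close> be the common denominator of \<open>\<rho>\<close> and \<open>\<sigma>\<close>. The curvature is the Jacobian of \<open>\<xi>\<close>
  divided by \<open>- E\<close>, and \<open>\<Delta>\<close> is a negative multiple of \<open>E\<close>. As \<open>d_plus\<close> and \<open>d_minus\<close> are affine in \<open>r\<close>
  with slopes the derivatives of \<open>\<xi>\<close>, \<open>- E\<close> is a polynomial of degree at most two in \<open>r\<close> whose
  coefficient of \<open>r\<^sup>2\<close> is the Jacobian. So a nonzero Jacobian makes some \<open>\<Delta>\<close> nonzero, while for a zero Jacobian the curvature is \<open>0\<close> wherever it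
  is defined.\<close>
lemma curvature_nonzero_iff_jac:
  assumes "\<xi> differentiable (at \<nu>)"
  shows "(\<exists>r. Delta \<xi> F \<nu> r \<noteq> 0) \<and> (\<forall>r. Delta \<xi> F \<nu> r \<noteq> 0 \<longrightarrow> curvature \<xi> F \<nu> r \<noteq> 0)
     \<longleftrightarrow> jac \<xi> \<nu> \<noteq> 0"
proof -
  define E where "E r = d_minus \<xi> F \<nu> r * cnj (d_minus \<xi> F \<nu> r) - d_plus \<xi> F \<nu> r * cnj (d_plus \<xi> F \<nu> r)" for r
  have Delta: "Delta \<xi> F \<nu> r \<noteq> 0 \<longleftrightarrow> E r \<noteq> 0" for r
    using one_plus_norm_nonzero[of "\<xi> \<nu>"] by (auto simp: Delta_def E_def)
  have K: "curvature \<xi> F \<nu> r = - jac \<xi> \<nu> / E r" if "E r \<noteq> 0" for r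
    using norm_determinant_identity that
    unfolding curvature_def opt_rho_def opt_sigma_def d_nu_cnj[OF assms] E_def jac_def by blast
  have plus: "d_plus \<xi> F \<nu> r = d_plus \<xi> F \<nu> 0 + of_real r * d_nu \<xi> \<nu>"
    and minus: "d_minus \<xi> F \<nu> r = d_minus \<xi> F \<nu> 0 + of_real r * d_nubar \<xi> \<nu>" for r
    by (simp_all add: d_plus_def d_minus_def)
  have "\<exists>r. E r \<noteq> 0" if "jac \<xi> \<nu> \<noteq> 0"
  proof (rule ccontr)
    assume "\<not> ?thesis"
    then have 0: "E 0 = 0" "E 1 = 0" "E (-1) = 0" by auto
    \<comment> \<open>The second difference of a quadratic polynomial is twice its leading coefficient.\<close>
    have "E 1 + E (-1) - 2 * E 0 = - 2 * jac \<xi> \<nu>"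
      by (simp add: E_def plus[of 1] plus[of "- 1"] minus[of 1] minus[of "- 1"] jac_def algebra_simps)
    then show False using 0 that by simp
  qed
  then show ?thesis using Delta K by auto
qed

section \<open>Passing between stereographic coordinate and direction\<close>

definition stereo :: "real^3 \<Rightarrow> complex" where
  "stereo x = (1 / (1 + x$3)) *\<^sub>R Complex (x$1) (x$2)"

definition unstereo :: "complex \<Rightarrow> real^3" where
  "unstereo \<xi> = (1 / (1 + (Re \<xi>)\<^sup>2 + (Im \<xi>)\<^sup>2)) *\<^sub>R
     ((2 * Re \<xi>) *\<^sub>R axis 1 1 + (2 * Im \<xi>) *\<^sub>R axis 2 1 + (1 - (Re \<xi>)\<^sup>2 - (Im \<xi>)\<^sup>2) *\<^sub>R axis 3 1)"

lemma unstereo_nth: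
  "unstereo \<xi> $ 1 = 2 * Re \<xi> / (1 + (Re \<xi>)\<^sup>2 + (Im \<xi>)\<^sup>2)"
  "unstereo \<xi> $ 2 = 2 * Im \<xi> / (1 + (Re \<xi>)\<^sup>2 + (Im \<xi>)\<^sup>2)"
  "unstereo \<xi> $ 3 = (1 - (Re \<xi>)\<^sup>2 - (Im \<xi>)\<^sup>2) / (1 + (Re \<xi>)\<^sup>2 + (Im \<xi>)\<^sup>2)"
  by (simp_all add: unstereo_def axis_def)

lemma one_plus_squares_pos: "1 + a\<^sup>2 + b\<^sup>2 > (0::real)"
  by (metis add.assoc add_pos_nonneg sum_power2_ge_zero zero_less_one)

lemma stereo_unstereo: "stereo (unstereo \<xi>) = \<xi>"
proof -
  let ?n = "1 + (Re \<xi>)\<^sup>2 + (Im \<xi>)\<^sup>2"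
  have n: "?n > 0" by (rule one_plus_squares_pos)
  then have "1 + unstereo \<xi> $ 3 = 2 / ?n" by (simp add: unstereo_nth field_simps)
  then show ?thesis using n by (simp add: stereo_def unstereo_nth complex_eq_iff)
qed

lemma unstereo_direction:
  assumes "l \<in> oriented_lines" "line_dir l \<noteq> south"
  shows "line_dir l = unstereo (fst (line_coords l))"
proof -
  obtain \<xi> F where c: "line_coords l = (\<xi>, F)" by force
  have "case line_coords l of (\<xi>, F) \<Rightarrow> \<forall>r. line_point \<xi> F r = fst l + r *\<^sub>R snd l"
    using theI'[OF line_coords_ex1[OF assms]] unfolding line_coords_def .
  then have P: "line_point \<xi> F r = fst l + r *\<^sub>R snd l" for r by (simp add: c)
  have d: "snd l = line_point \<xi> F 1 - line_point \<xi> F 0" using P[of 1] P[of 0] by simp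
  have n: "1 + \<xi> * cnj \<xi> = of_real (1 + (Re \<xi>)\<^sup>2 + (Im \<xi>)\<^sup>2)"
    by (simp add: complex_eq_iff power2_eq_square)
  have m: "1 - \<xi> * cnj \<xi> = of_real (1 - (Re \<xi>)\<^sup>2 - (Im \<xi>)\<^sup>2)"
    by (simp add: complex_eq_iff power2_eq_square)
  have "line_point_z \<xi> F 1 - line_point_z \<xi> F 0 = 2 * \<xi> / of_real (1 + (Re \<xi>)\<^sup>2 + (Im \<xi>)\<^sup>2)"
    by (subst line_point_z_affine) (simp add: n)
  then have 1: "Re (line_point_z \<xi> F 1) - Re (line_point_z \<xi> F 0) = 2 * Re \<xi> / (1 + (Re \<xi>)\<^sup>2 + (Im \<xi>)\<^sup>2)"
    "Im (line_point_z \<xi> F 1) - Im (line_point_z \<xi> F 0) = 2 * Im \<xi> / (1 + (Re \<xi>)\<^sup>2 + (Im \<xi>)\<^sup>2)"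
    by (simp_all only: minus_complex.sel[symmetric] Re_divide_of_real Im_divide_of_real) simp_all
  have "line_point_t \<xi> F 1 - line_point_t \<xi> F 0 =
      of_real ((1 - (Re \<xi>)\<^sup>2 - (Im \<xi>)\<^sup>2) / (1 + (Re \<xi>)\<^sup>2 + (Im \<xi>)\<^sup>2))"
    by (subst line_point_t_affine) (simp only: n m of_real_divide, simp)
  then have 2: "Re (line_point_t \<xi> F 1) - Re (line_point_t \<xi> F 0) =
      (1 - (Re \<xi>)\<^sup>2 - (Im \<xi>)\<^sup>2) / (1 + (Re \<xi>)\<^sup>2 + (Im \<xi>)\<^sup>2)"
    by (simp only: minus_complex.sel[symmetric] Re_complex_of_real)
  show ?thesis
    using d 1 2 by (simp add: c vec_eq_iff forall_3 unstereo_nth line_point_def)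
qed

lemma unstereo_differentiable: "unstereo differentiable (at \<xi>)"
proof -
  have "1 + (Re \<xi>)\<^sup>2 + (Im \<xi>)\<^sup>2 \<noteq> 0" using one_plus_squares_pos[of "Re \<xi>" "Im \<xi>"] by simp
  then show ?thesis
    unfolding unstereo_def[abs_def] differentiable_def
    by (intro exI) (rule derivative_eq_intros refl | assumption)+
qed

lemma stereo_differentiable:
  assumes "x $ 3 \<noteq> - 1"
  shows "stereo differentiable (at x)"
proof -
  have eq: "stereo = (\<lambda>x. (1 / (1 + x$3)) *\<^sub>R ((x$1) *\<^sub>R 1 + (x$2) *\<^sub>R \<i>))"
    by (auto simp: stereo_def fun_eq_iff complex_eq_iff)
  have "1 + x $ 3 \<noteq> 0" using assms by linarith
  then show ?thesis
    unfolding eq differentiable_def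
    by (intro exI) (rule derivative_eq_intros refl bounded_linear.has_derivative[OF bounded_linear_vec_nth] | assumption)+
qed

text \<open>On unit vectors other than the South pole, direction and coordinate are differentiable
  functions of one another, so by the chain rule each of their derivatives factors through the
  other one, and both are injective together.\<close>
lemma param_curvature_nonzero_iff:
  assumes "open S" "\<nu> \<in> S" "g ` S \<subseteq> oriented_lines" "continuous_on S g"
    and D: "(g has_derivative D) (at \<nu>)" and "line_dir (g \<nu>) \<noteq> south"
  shows "param_curvature_nonzero g \<nu> \<longleftrightarrow> inj (line_dir \<circ> D)"
proof -
  define \<xi> where "\<xi> = fst \<circ> line_coords \<circ> g"
  define T where "T = S \<inter> (\<lambda>x. snd (g x)) -` (- {south})"
  have T: "open T" "\<nu> \<in> T"
    unfolding T_def using assms continuous_open_preimage[OF continuous_on_snd[OF assms(4)] assms(1)]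
    by (auto simp: open_Compl)
  have W: "snd (g x) = unstereo (\<xi> x)" if "x \<in> T" for x
    using unstereo_direction[of "g x"] that assms(3) by (auto simp: T_def \<xi>_def)
  have xi: "\<xi> x = stereo (snd (g x))" if "x \<in> T" for x
    using W[OF that] by (simp add: stereo_unstereo)
  have dW: "((\<lambda>x. snd (g x)) has_derivative (snd \<circ> D)) (at \<nu>)"
    using has_derivative_snd[OF D] by (simp add: comp_def)
  have "snd (g \<nu>) $ 3 \<noteq> -1"
    using one_plus_squares_pos[of "Re (\<xi> \<nu>)" "Im (\<xi> \<nu>)"]
    by (simp add: W[OF T(2)] unstereo_nth divide_simps)
  then obtain P where P: "(stereo has_derivative P) (at (snd (g \<nu>)))"
    using stereo_differentiable differentiable_def by blast
  have dxi: "(\<xi> has_derivative P \<circ> (snd \<circ> D)) (at \<nu>)"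
    unfolding comp_def
    by (rule has_derivative_transform_within_open[OF has_derivative_compose[OF dW[unfolded comp_def] P] T])
       (simp add: xi)
  obtain Q where Q: "(unstereo has_derivative Q) (at (\<xi> \<nu>))"
    using unstereo_differentiable differentiable_def by blast
  have "((\<lambda>x. snd (g x)) has_derivative Q \<circ> (P \<circ> (snd \<circ> D))) (at \<nu>)"
    unfolding comp_def
    by (rule has_derivative_transform_within_open[OF has_derivative_compose[OF dxi[unfolded comp_def] Q] T])
       (simp add: W)
  then have "snd \<circ> D = Q \<circ> (P \<circ> (snd \<circ> D))" using dW has_derivative_unique by blast
  then have "inj (snd \<circ> D) \<longleftrightarrow> inj (P \<circ> (snd \<circ> D))"
    by (metis inj_on_imageI2)
  also have "\<dots> \<longleftrightarrow> jac \<xi> \<nu> \<noteq> 0" using inj_derivative_iff_jac[OF dxi] .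
  also have "\<dots> \<longleftrightarrow> param_curvature_nonzero g \<nu>"
    unfolding param_curvature_nonzero_def Let_def \<xi>_def[symmetric]
    using curvature_nonzero_iff_jac dxi differentiable_def by blast
  finally show ?thesis by simp
qed

text \<open>A rotation acts on the directions by an invertible linear map, so it does not affect injectivity
  of the derivative of the direction.\<close>
lemma rotated_curvature_nonzero_iff:
  assumes "open S" "\<nu> \<in> S" "g ` S \<subseteq> oriented_lines" "continuous_on S g"
    and D: "(g has_derivative D) (at \<nu>)"
    and Q: "rotation_matrix Q" "Q *v line_dir (g \<nu>) \<noteq> south"
  shows "param_curvature_nonzero (rotate_line Q \<circ> g) \<nu> \<longleftrightarrow> inj (line_dir \<circ> D)"
proof -
  have orth: "orthogonal_transformation ((*v) Q)"
    using Q(1) by (simp add: rotation_matrix_def orthogonal_transformation_matrix)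
  have bl: "bounded_linear (rotate_line Q)"
    unfolding rotate_line_def[abs_def]
    by (intro bounded_linear_Pair bounded_linear_compose[OF matrix_vector_mul_bounded_linear]
        bounded_linear_fst bounded_linear_snd)
  have "param_curvature_nonzero (rotate_line Q \<circ> g) \<nu> \<longleftrightarrow> inj (line_dir \<circ> (\<lambda>v. rotate_line Q (D v)))"
  proof (rule param_curvature_nonzero_iff[OF assms(1,2)])
    show "(rotate_line Q \<circ> g) ` S \<subseteq> oriented_lines"
      using assms(3) orth by (auto simp: oriented_lines_def rotate_line_def orthogonal_transformation_def
          orthogonal_transformation_norm split: prod.splits)
    show "continuous_on S (rotate_line Q \<circ> g)"
      unfolding comp_def by (rule bounded_linear.continuous_on[OF bl assms(4)])
    show "((rotate_line Q \<circ> g) has_derivative (\<lambda>v. rotate_line Q (D v))) (at \<nu>)"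
      unfolding comp_def by (rule bounded_linear.has_derivative[OF bl D])
  qed (use Q in \<open>simp add: rotate_line_def\<close>)
  also have "line_dir \<circ> (\<lambda>v. rotate_line Q (D v)) = (*v) Q \<circ> (line_dir \<circ> D)"
    by (auto simp: rotate_line_def)
  also have "inj \<dots> \<longleftrightarrow> inj (line_dir \<circ> D)"
    using orthogonal_transformation_inj[OF orth] by (metis inj_compose inj_on_imageI2)
  finally show ?thesis .
qed

text \<open>Without this the condition imposed on lines in the South pole direction would be vacuous.\<close>
lemma rotation_moving_south: "\<exists>Q. rotation_matrix Q \<and> Q *v south \<noteq> south"
proof -
  obtain h where h: "orthogonal_transformation h" "det (matrix h) = 1" "h south = - south"
    using rotation_exists[of south "- south"] by auto
  then have "rotation_matrix (matrix h)" "matrix h *v south = - south"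
    by (simp_all add: rotation_matrix_def orthogonal_transformation_matrix matrix_works)
  moreover have "- south \<noteq> south" by (simp add: south_def vec_eq_iff forall_3)
  ultimately show ?thesis by metis
qed

section \<open>Graphs of sections\<close>

text \<open>A line of a graph is recovered from its direction: \<open>g = s \<circ> W\<close> with \<open>W\<close> the direction and
  \<open>s\<close> the section. So \<open>Dg\<close> factors through \<open>DW\<close>, and the injectivity of the former passes to
  the latter.\<close>
lemma direction_immersive_if_graph:
  assumes "open N" "\<nu> \<in> N" and D: "(g has_derivative D) (at \<nu>)" and "inj D"
    and "smooth_section_on V s" "g ` N \<subseteq> s ` V"
  shows "inj (line_dir \<circ> D)"
proof -
  have sec: "snd (g x) \<in> V" "g x = s (snd (g x))" if "x \<in> N" for x
    using assms(5,6) that unfolding smooth_section_on_def by force+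
  obtain M h where M: "open M" "snd (g \<nu>) \<in> M" "smooth_on M h" "\<And>y. y \<in> M \<inter> V \<Longrightarrow> h y = s y"
    using assms(5) sec(1)[OF assms(2)] unfolding smooth_section_on_def smooth_map_on_def by blast
  define H where "H = frechet_derivative h (at (snd (g \<nu>)))"
  have dW: "((\<lambda>x. snd (g x)) has_derivative (snd \<circ> D)) (at \<nu>)"
    using has_derivative_snd[OF D] by (simp add: comp_def)
  have "(h has_derivative H) (at (snd (g \<nu>)))"
    unfolding H_def using smooth_on_has_derivative M by blast
  from has_derivative_compose[OF dW this]
  have "((\<lambda>x. h (snd (g x))) has_derivative H \<circ> (snd \<circ> D)) (at \<nu>)" by (simp add: comp_def)
  moreover have "\<forall>\<^sub>F x in at \<nu>. h (snd (g x)) = g x"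
  proof -
    have "((\<lambda>x. snd (g x)) \<longlongrightarrow> snd (g \<nu>)) (at \<nu>)"
      using has_derivative_continuous[OF dW] by (simp add: continuous_at)
    then have "\<forall>\<^sub>F x in at \<nu>. snd (g x) \<in> M" using M(1,2) by (rule topological_tendstoD)
    moreover have "\<forall>\<^sub>F x in at \<nu>. x \<in> N" using assms(1,2) by (rule eventually_at_in_open')
    ultimately show ?thesis by eventually_elim (use M(4) sec in auto)
  qed
  moreover have "h (snd (g \<nu>)) = g \<nu>" using M(2,4) sec assms(2) by auto
  ultimately have "(g has_derivative H \<circ> (snd \<circ> D)) (at \<nu>)"
    by (rule has_derivative_transform_eventually) simp
  then have "D = H \<circ> (snd \<circ> D)" using D has_derivative_unique by blast
  then show ?thesis using assms(4) by (metis inj_on_imageI2)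
qed

text \<open>The two inner products fix the orthogonal projection to the plane perpendicular to \<open>c\<close>,
  because \<open>a\<close>, \<open>b\<close> span it; the unit sphere meets each line parallel to \<open>c\<close> at most once in the open hemisphere
  around \<open>c\<close>.\<close>
lemma unit_vector_determined:
  fixes a b c y z :: "real^3"
  assumes "a \<bullet> c = 0" "b \<bullet> c = 0" "norm c = 1" "cross3 a b \<noteq> 0"
    and "norm y = 1" "norm z = 1" "y \<bullet> c > 0" "z \<bullet> c > 0" "y \<bullet> a = z \<bullet> a" "y \<bullet> b = z \<bullet> b"
  shows "y = z"
proof -
  define n where "n = cross3 a b"
  have perp: "cross3 x n = 0" if "x \<bullet> a = 0" "x \<bullet> b = 0" for x
    using that unfolding n_def by (simp add: Lagrange)
  have "c \<noteq> 0" using assms(3) by auto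
  have cc: "c \<bullet> c = 1" using assms(3) by (simp add: norm_eq_1)
  \<comment> \<open>The projection of \<open>y - z\<close> to the plane; both \<open>d\<close> and \<open>c\<close> are parallel to the
    normal \<open>n\<close>, and they are orthogonal to each other, so \<open>d = 0\<close>.\<close>
  define d where "d = (y - z) - ((y - z) \<bullet> c) *\<^sub>R c"
  have d: "d \<bullet> c = 0" "d \<bullet> a = 0" "d \<bullet> b = 0"
    using assms cc by (simp_all add: d_def inner_simps inner_commute)
  have "cross3 c n = 0" using perp assms(1,2) by (simp add: inner_commute)
  have "d = 0"
  proof -
    have nz: "c \<bullet> n \<noteq> 0" using \<open>cross3 c n = 0\<close> \<open>c \<noteq> 0\<close> assms(4) norm_and_cross_eq_0[of c n] n_def by auto
    have "n = (c \<bullet> n) *\<^sub>R c"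
    proof -
      have "cross3 c (cross3 c n) = (c \<bullet> n) *\<^sub>R c - (c \<bullet> c) *\<^sub>R n" by (rule Lagrange)
      then show ?thesis using \<open>cross3 c n = 0\<close> cc by simp
    qed
    then have "d \<bullet> n = 0" using d(1) by (metis inner_scaleR_right mult_zero_right)
    moreover have "cross3 d n = 0" using perp d by simp
    ultimately show ?thesis using norm_and_cross_eq_0[of d n] assms(4) n_def by auto
  qed
  then obtain t where t: "y = z + t *\<^sub>R c" unfolding d_def by (metis add.commute diff_eq_eq right_minus_eq)
  have "y \<bullet> y = 1" "z \<bullet> z = 1" using assms by (simp_all add: norm_eq_1)
  then have "t * (y \<bullet> c + z \<bullet> c) = 0"
    unfolding t by (simp add: inner_simps inner_commute cc algebra_simps)
  then show ?thesis using assms(7,8) t by auto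
qed

text \<open>The tangent vectors \<open>a\<close>, \<open>b\<close> of the direction map \<open>W\<close> span the tangent plane of the sphere
  at \<open>c = W \<nu>\<close>, so \<open>L y = (y \<bullet> a, y \<bullet> b)\<close> is a coordinate of the sphere near \<open>c\<close>, and \<open>P = L \<circ> W\<close> has
  a smooth local inverse \<open>h\<close>. The section is \<open>s = g \<circ> h \<circ> L\<close>. A linear coordinate is preferred to
  the stereographic one because it needs no case distinction for the South pole and makes \<open>s\<close>
  smooth on an open subset of the ambient space.\<close>
lemma graph_if_direction_immersive:
  fixes g :: "complex \<Rightarrow> oline"
  assumes S: "open S" "smooth_on S g" "g ` S \<subseteq> oriented_lines" "\<nu> \<in> S"
    and inj: "inj (line_dir \<circ> frechet_derivative g (at \<nu>))"
  obtains N V s where "open N" "\<nu> \<in> N" "N \<subseteq> S" "inj_on g N"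
    "openin (top_of_set (sphere 0 1)) V" "smooth_section_on V s" "g ` N = s ` V"
proof -
  define D where "D = frechet_derivative g (at \<nu>)"
  define W where "W x = snd (g x)" for x
  define c where "c = W \<nu>"
  define a b where "a = snd (D 1)" and "b = snd (D \<i>)"
  have D: "(g has_derivative D) (at \<nu>)" unfolding D_def using S by (simp add: smooth_on_has_derivative)
  then have linD: "linear D" using has_derivative_linear by blast
  have dW: "(W has_derivative (\<lambda>v. snd (D v))) (at \<nu>)" unfolding W_def using has_derivative_snd[OF D] .
  have Dv: "snd (D v) = Re v *\<^sub>R a + Im v *\<^sub>R b" for v
    unfolding a_def b_def by (subst linear_complex_basis[OF linD]) simp
  have ker: "v = 0" if "snd (D v) = 0" for v
    using inj that linear_0[OF linD] unfolding D_def[symmetric] inj_def by (metis comp_apply snd_zero)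
  have normW: "norm (W x) = 1" if "x \<in> S" for x using S(3) that unfolding W_def oriented_lines_def by force
  have perp: "snd (D v) \<bullet> c = 0" for v
  proof -
    have "((\<lambda>x. W x \<bullet> W x) has_derivative (\<lambda>v. W \<nu> \<bullet> snd (D v) + snd (D v) \<bullet> W \<nu>)) (at \<nu>)"
      by (intro has_derivative_inner dW)
    moreover have "((\<lambda>x. W x \<bullet> W x) has_derivative (\<lambda>v. 0)) (at \<nu>)"
      by (rule has_derivative_transform_within_open[OF has_derivative_const S(1,4), of 1])
         (use normW in \<open>simp add: norm_eq_1\<close>)
    ultimately have "(\<lambda>v. W \<nu> \<bullet> snd (D v) + snd (D v) \<bullet> W \<nu>) = (\<lambda>v. 0)" by (rule has_derivative_unique)
    then have "W \<nu> \<bullet> snd (D v) + snd (D v) \<bullet> W \<nu> = 0" by metis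
    then show ?thesis by (simp add: c_def inner_commute)
  qed
  have ab: "cross3 a b \<noteq> 0"
  proof
    assume "cross3 a b = 0"
    have "a \<noteq> 0" using ker[of 1] Dv[of 1] by auto
    moreover have "b \<noteq> 0" using ker[of \<i>] Dv[of \<i>] by auto
    ultimately obtain t where "b = t *\<^sub>R a"
      using \<open>cross3 a b = 0\<close> unfolding cross_eq_0 collinear_lemma by auto
    then have "snd (D (Complex (- t) 1)) = 0" by (simp add: Dv)
    then have "Complex (- t) 1 = 0" by (rule ker)
    then show False by (simp add: complex_eq_iff)
  qed
  define L where "L x = Complex (x \<bullet> a) (x \<bullet> b)" for x
  have L: "bounded_linear L"
  proof -
    have "L = (\<lambda>x. (x \<bullet> a) *\<^sub>R 1 + (x \<bullet> b) *\<^sub>R \<i>)" by (auto simp: L_def complex_eq_iff)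
    then show ?thesis
      by (simp only:) (intro bounded_linear_add bounded_linear_compose[OF bounded_linear_scaleR_left]
          bounded_linear_inner_left)
  qed
  define P where "P x = L (W x)" for x
  \<comment> \<open>Parameters whose direction lies in the hemisphere around \<open>c\<close>, where \<open>L\<close> is injective on the
    sphere.\<close>
  define S' where "S' = S \<inter> (\<lambda>x. W x \<bullet> c) -` {0<..}"
  have smW: "smooth_on S W" unfolding W_def using smooth_on_linear[OF bounded_linear_snd S(1,2)] .
  have "open S'" unfolding S'_def
    using S(1) smooth_on_imp_continuous_on[OF smW]
    by (intro continuous_open_preimage continuous_intros) auto
  moreover have "\<nu> \<in> S'" using normW[OF S(4)] S(4) by (simp add: S'_def c_def norm_eq_1)
  moreover have S'S: "S' \<subseteq> S" by (auto simp: S'_def)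
  have "smooth_on S P" unfolding P_def by (rule smooth_on_linear[OF L S(1) smW])
  then have "smooth_on S' P" using S'S smooth_on_subset by blast
  moreover have "inj (frechet_derivative P (at \<nu>))"
  proof -
    have dP: "(P has_derivative (\<lambda>v. L (snd (D v)))) (at \<nu>)"
      unfolding P_def by (rule bounded_linear.has_derivative[OF L dW])
    have "v = 0" if "L (snd (D v)) = 0" for v
    proof (rule ker)
      have "snd (D v) \<bullet> a = 0" "snd (D v) \<bullet> b = 0" using that by (simp_all add: L_def complex_eq_iff)
      then have "snd (D v) \<bullet> snd (D v) = 0"
        by (subst (2) Dv) (simp add: inner_add_right)
      then show "snd (D v) = 0" by simp
    qed
    then have "inj (\<lambda>v. L (snd (D v)))"
      using linear_injective_0[OF has_derivative_linear[OF dP]] by blast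
    then show ?thesis using frechet_derivative_at[OF dP] by simp
  qed
  ultimately obtain N h where N: "open N" "\<nu> \<in> N" "N \<subseteq> S'" "open (P ` N)" "smooth_on (P ` N) h"
    and hP: "\<And>y. y \<in> N \<Longrightarrow> h (P y) = y"
    using smooth_local_inverse[of S' P \<nu>] by blast
  define B where "B = {y. y \<bullet> c > 0} \<inter> L -` (P ` N)"
  have "open {y. y \<bullet> c > 0}" by (intro open_Collect_less continuous_intros)
  moreover have "open (L -` (P ` N))"
    using N(4) L by (intro open_vimage linear_continuous_on)
  ultimately have "open B" unfolding B_def by (rule open_Int)
  define V where "V = sphere 0 1 \<inter> B"
  define s where "s y = g (h (L y))" for y
  have hN: "h ` P ` N \<subseteq> N" using hP by auto
  have smB: "smooth_on B s"
  proof -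
    have "smooth_on N g" using S(2) N(3) S'S smooth_on_subset by blast
    then have gh: "smooth_on (P ` N) (\<lambda>y. g (h y))"
      by (rule smooth_on_compose[OF N(4,1) hN _ N(5)])
    have "smooth_on B (\<lambda>y. y)" unfolding smooth_on_def using Ck_on_id[OF \<open>open B\<close>] by blast
    then have smL: "smooth_on B L" by (rule smooth_on_linear[OF L \<open>open B\<close>])
    show ?thesis unfolding s_def
      by (rule smooth_on_compose[OF \<open>open B\<close> N(4) _ gh smL]) (auto simp: B_def)
  qed
  have VW: "W x \<in> V" "s (W x) = g x" if "x \<in> N" for x
    using that N(3) S'S normW hP by (auto simp: V_def B_def S'_def P_def s_def)
  have sV: "s y \<in> g ` N" "snd (s y) = y" if y: "y \<in> V" for y
  proof -
    obtain x where x: "x \<in> N" "L y = P x" using y unfolding V_def B_def by blast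
    have s: "s y = g x" using x hP by (simp add: s_def)
    then show "s y \<in> g ` N" using x by blast
    have "W x = y"
    proof (rule unit_vector_determined[OF _ _ _ ab])
      show "a \<bullet> c = 0" "b \<bullet> c = 0" using perp by (simp_all add: a_def b_def)
      show "norm c = 1" using normW S(4) c_def by simp
      show "norm (W x) = 1" "W x \<bullet> c > 0" using x N(3) S'S normW by (auto simp: S'_def)
      show "norm y = 1" "y \<bullet> c > 0" using y by (auto simp: V_def B_def)
      show "W x \<bullet> a = y \<bullet> a" "W x \<bullet> b = y \<bullet> b" using x(2) by (simp_all add: P_def L_def)
    qed
    then show "snd (s y) = y" by (simp add: s W_def)
  qed
  show thesis
  proof (rule that[OF N(1,2)])
    show "N \<subseteq> S" using N(3) S'S by blast
    show "inj_on g N"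
      by (rule inj_on_inverseI[of _ "\<lambda>l. h (L (snd l))"]) (rule hP[unfolded P_def W_def])
    show "openin (top_of_set (sphere 0 1)) V" unfolding V_def using \<open>open B\<close> by (rule openin_open_Int)
    show "g ` N = s ` V"
    proof
      show "g ` N \<subseteq> s ` V" using VW by (metis image_eqI image_subsetI)
      show "s ` V \<subseteq> g ` N" using sV by blast
    qed
    show "smooth_section_on V s"
      unfolding smooth_section_on_def smooth_map_on_def
    proof (intro conjI ballI)
      fix y assume "y \<in> V"
      show "\<exists>N h. open N \<and> y \<in> N \<and> smooth_on N h \<and> (\<forall>y\<in>N \<inter> V. h y = s y)"
        using \<open>open B\<close> smB \<open>y \<in> V\<close> unfolding V_def by blast
      show "s y \<in> oriented_lines" using sV(1)[OF \<open>y \<in> V\<close>] N(3) S'S S(3) by blast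
      show "line_dir (s y) = y" using sV(2)[OF \<open>y \<in> V\<close>] .
    qed
  qed
qed

section \<open>Charts of a congruence\<close>

lemma chart_of_congruence:
  assumes "line_congruence X A f" "(U, \<phi>) \<in> A"
  shows "openin X U" "open (\<phi> ` U)" "inj_on \<phi> U"
    "\<And>T. T \<subseteq> U \<Longrightarrow> open (\<phi> ` T) \<longleftrightarrow> openin X T"
    "smooth_on (\<phi> ` U) (f \<circ> inv_into U \<phi>)"
    "(f \<circ> inv_into U \<phi>) ` \<phi> ` U \<subseteq> oriented_lines"
    "\<And>x. x \<in> U \<Longrightarrow> inj (frechet_derivative (f \<circ> inv_into U \<phi>) (at (\<phi> x)))"
proof -
  have h: "homeomorphic_map (subtopology X U) (top_of_set (\<phi> ` U)) \<phi>"
    and U: "openin X U" and o: "open (\<phi> ` U)"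
    and im: "immersion_on (\<phi> ` U) (f \<circ> inv_into U \<phi>)" and lines: "f ` topspace X \<subseteq> oriented_lines"
    using assms unfolding line_congruence_def smooth_surface_def by fastforce+
  show "openin X U" "open (\<phi> ` U)" by fact+
  have top: "topspace (subtopology X U) = U" using openin_subset[OF U] by auto
  show inj: "inj_on \<phi> U" using homeomorphic_imp_injective_map[OF h] top by simp
  show "open (\<phi> ` T) \<longleftrightarrow> openin X T" if "T \<subseteq> U" for T
  proof -
    have "openin (top_of_set (\<phi> ` U)) (\<phi> ` T) \<longleftrightarrow> openin (subtopology X U) T"
      using homeomorphic_map_openness[OF h, of T] that openin_subset[OF U] by auto
    then show ?thesis
      using openin_open_eq[OF o] openin_open_subtopology[OF U] that by (simp add: image_mono)
  qed
  show "smooth_on (\<phi> ` U) (f \<circ> inv_into U \<phi>)"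
    "\<And>x. x \<in> U \<Longrightarrow> inj (frechet_derivative (f \<circ> inv_into U \<phi>) (at (\<phi> x)))"
    using im unfolding immersion_on_def by auto
  show "(f \<circ> inv_into U \<phi>) ` \<phi> ` U \<subseteq> oriented_lines"
  proof (rule image_subsetI)
    fix y assume "y \<in> \<phi> ` U"
    then obtain x where x: "x \<in> U" "y = \<phi> x" by blast
    then have "(f \<circ> inv_into U \<phi>) y = f x" using inj by simp
    moreover have "f x \<in> oriented_lines" using lines openin_subset[OF U] x(1) by blast
    ultimately show "(f \<circ> inv_into U \<phi>) y \<in> oriented_lines" by (simp only:)
  qed
qed

lemma curvature_nonzero_at_iff:
  assumes "line_congruence X A f"
  shows "curvature_nonzero_at A f m \<longleftrightarrow>
    (\<forall>(U, \<phi>)\<in>A. m \<in> U \<longrightarrow> inj (line_dir \<circ> frechet_derivative (f \<circ> inv_into U \<phi>) (at (\<phi> m))))"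
proof -
  have "(if line_dir (f m) \<noteq> south
         then param_curvature_nonzero (f \<circ> inv_into U \<phi>) (\<phi> m)
         else \<forall>Q. rotation_matrix Q \<and> Q *v line_dir (f m) \<noteq> south \<longrightarrow>
                param_curvature_nonzero (rotate_line Q \<circ> f \<circ> inv_into U \<phi>) (\<phi> m)) \<longleftrightarrow>
        inj (line_dir \<circ> frechet_derivative (f \<circ> inv_into U \<phi>) (at (\<phi> m)))"
    if "(U, \<phi>) \<in> A" "m \<in> U" for U \<phi>
  proof -
    note c = chart_of_congruence[OF assms that(1)]
    let ?g = "f \<circ> inv_into U \<phi>"
    have gm: "inv_into U \<phi> (\<phi> m) = m" using c(3) that(2) by simp
    have m: "\<phi> m \<in> \<phi> ` U" using that(2) by blast
    note hyps = c(2) m c(6) smooth_on_imp_continuous_on[OF c(5)] smooth_on_has_derivative[OF c(5) m]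
    show ?thesis
    proof (cases "line_dir (f m) = south")
      case False
      then show ?thesis using param_curvature_nonzero_iff[OF hyps] by (simp add: gm)
    next
      case True
      have "param_curvature_nonzero (rotate_line Q \<circ> f \<circ> inv_into U \<phi>) (\<phi> m) \<longleftrightarrow>
          inj (line_dir \<circ> frechet_derivative ?g (at (\<phi> m)))"
        if "rotation_matrix Q" "Q *v south \<noteq> south" for Q
        using rotated_curvature_nonzero_iff[OF hyps that(1)] that(2) True by (simp add: gm o_assoc)
      then show ?thesis using rotation_moving_south True by auto
    qed
  qed
  then show ?thesis unfolding curvature_nonzero_at_def by fast
qed

theorem theorem1:
  fixes X :: "'m topology"
    and A :: "('m set \<times> ('m \<Rightarrow> complex)) set"
    and f :: "'m \<Rightarrow> (real^3) \<times> (real^3)"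
  assumes "line_congruence X A f"
  shows "(\<forall>m\<in>topspace X. locally_graph_at X f m) \<longleftrightarrow>
         (\<forall>m\<in>topspace X. curvature_nonzero_at A f m)"
proof (rule ball_cong[OF refl])
  fix m assume "m \<in> topspace X"
  show "locally_graph_at X f m \<longleftrightarrow> curvature_nonzero_at A f m"
    unfolding curvature_nonzero_at_iff[OF assms]
  proof
    assume "locally_graph_at X f m"
    then obtain N V s where N: "openin X N" "m \<in> N" "smooth_section_on V s" "f ` N = s ` V"
      unfolding locally_graph_at_def by blast
    show "\<forall>(U, \<phi>)\<in>A. m \<in> U \<longrightarrow> inj (line_dir \<circ> frechet_derivative (f \<circ> inv_into U \<phi>) (at (\<phi> m)))"
    proof clarify
      fix U \<phi> assume c0: "(U, \<phi>) \<in> A" "m \<in> U"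
      note c = chart_of_congruence[OF assms c0(1)]
      have "open (\<phi> ` (N \<inter> U))" using c(1,4) N(1) by (simp add: openin_Int)
      moreover have "\<phi> m \<in> \<phi> ` (N \<inter> U)" using N(2) c0 by blast
      moreover have "(f \<circ> inv_into U \<phi>) ` \<phi> ` (N \<inter> U) \<subseteq> s ` V"
        using N(4) c(3) by force
      ultimately show "inj (line_dir \<circ> frechet_derivative (f \<circ> inv_into U \<phi>) (at (\<phi> m)))"
        using direction_immersive_if_graph[OF _ _ smooth_on_has_derivative[OF c(5)] c(7)[OF c0(2)] N(3)] c0(2)
        by blast
    qed
  next
    assume inj: "\<forall>(U, \<phi>)\<in>A. m \<in> U \<longrightarrow> inj (line_dir \<circ> frechet_derivative (f \<circ> inv_into U \<phi>) (at (\<phi> m)))"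
    have "(\<Union>(U, \<phi>)\<in>A. U) = topspace X"
      using assms unfolding line_congruence_def smooth_surface_def by blast
    then obtain U \<phi> where c0: "(U, \<phi>) \<in> A" "m \<in> U"
      using \<open>m \<in> topspace X\<close> by blast
    note c = chart_of_congruence[OF assms c0(1)]
    let ?g = "f \<circ> inv_into U \<phi>"
    have "inj (line_dir \<circ> frechet_derivative ?g (at (\<phi> m)))" "\<phi> m \<in> \<phi> ` U" using inj c0 by auto
    then obtain M V s where M: "open M" "\<phi> m \<in> M" "M \<subseteq> \<phi> ` U" "inj_on ?g M"
      "openin (top_of_set (sphere 0 1)) V" "smooth_section_on V s" "?g ` M = s ` V"
      using graph_if_direction_immersive[OF c(2,5,6)] by metis
    define N where "N = U \<inter> \<phi> -` M"
    have "\<phi> ` N = M" using M(3) by (auto simp: N_def)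
    then have "openin X N" using c(4)[of N] M(1) by (simp add: N_def)
    have fN: "f x = ?g (\<phi> x)" if "x \<in> N" for x using that c(3) by (simp add: N_def)
    have "f ` N = ?g ` \<phi> ` N" using fN by (auto simp: image_image)
    then have "f ` N = s ` V" using M(7) \<open>\<phi> ` N = M\<close> by simp
    moreover have "inj_on f N"
    proof (rule inj_onI)
      fix x y assume xy: "x \<in> N" "y \<in> N" "f x = f y"
      then have "\<phi> x = \<phi> y" using fN inj_onD[OF M(4)] by (metis IntD2 N_def vimageE)
      then show "x = y" using c(3) xy(1,2) by (simp add: N_def inj_on_eq_iff)
    qed
    moreover have "m \<in> N" using c0(2) M(2) by (simp add: N_def)
    ultimately show "locally_graph_at X f m"
      unfolding locally_graph_at_def using \<open>openin X N\<close> M(5,6) by blast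
  qed
qed

end
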